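(* Let $T:[0,1]\to\mathbb{R}$ be the Takagi function, and let $$X^*:=[0,1]\setminus\bigcup_{x_0\in\mathcal{B}_1}I(x_0),$$ where $\mathcal{B}_1$ is the set of balanced dyadic rationals of generation $1$. Then $T$ maps $X^*$ onto $[0,\frac12]$. Moreover, $T$ is strictly increasing on $X^*\cap[0,\frac12)$.
   Context: The Takagi function is $T(x)=\sum_{n=0}^\infty 2^{-n}\phi(2^n x)$, where $\phi(x)=\operatorname{dist}(x,\mathbb{Z})$. For $x\in[0,1)$ write $x=0.\varepsilon_1\varepsilon_2\dots$ in binary (dyadic rationals get the expansion ending in all zeros) and put $D_k(x)=\sum_{j=1}^k(-1)^{\varepsilon_j}$. A dyadic rational $x_0=0.\varepsilon_1\dots\varepsilon_{2m}=k/2^{2m}$ ($m\in\mathbb{N}$) is balanced if $D_{2m}(x_0)=0$ (then $m$ is uniquely determined by $x_0$); it is of generation $n$ if there are exactly $n$ indices $1\le j\le 2m$ with $D_j(x_0)=0$. For such $x_0$, $I(x_0)=[k/2^{2m},(k+1)/2^{2m}]$. *)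

theory Defs
  imports "HOL-Analysis.Analysis"
begin

definition takagi :: "real \<Rightarrow> real" where
  "takagi x = (\<Sum>n. (1/2) ^ n * infdist (2 ^ n * x) \<int>)"

text \<open>For \<open>0 \<le> x < 1\<close> this selects the binary expansion that ends in zeros
  when \<open>x\<close> is a dyadic rational. Digits are indexed from \<open>j = 1\<close>.\<close>

definition bin_digit :: "nat \<Rightarrow> real \<Rightarrow> nat" where
  "bin_digit j x = nat \<lfloor>2 ^ j * x\<rfloor> mod 2"

definition sign_sum :: "nat \<Rightarrow> real \<Rightarrow> int" where
  "sign_sum k x = (\<Sum>j = 1..k. (- 1) ^ bin_digit j x)"

definition balanced_of_order :: "nat \<Rightarrow> real \<Rightarrow> bool" where
  "balanced_of_order m x \<longleftrightarrow>
     1 \<le> m \<and> (\<exists>k::nat. k < 2 ^ (2 * m) \<and> x = real k / 2 ^ (2 * m)) \<and> sign_sum (2 * m) x = 0"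

definition balanced :: "real \<Rightarrow> bool" where
  "balanced x \<longleftrightarrow> (\<exists>m. balanced_of_order m x)"

definition order_of :: "real \<Rightarrow> nat" where
  "order_of x = (THE m. balanced_of_order m x)"

definition generation :: "real \<Rightarrow> nat" where
  "generation x = card {j \<in> {1..2 * order_of x}. sign_sum j x = 0}"

definition balanced_gen :: "nat \<Rightarrow> real set" where
  "balanced_gen n = {x. balanced x \<and> generation x = n}"

text \<open>With \<open>m = order_of x\<close> and \<open>x = k / 2\<^sup>2\<^sup>m\<close>, the right end point is \<open>(k + 1) / 2\<^sup>2\<^sup>m\<close>.\<close>

definition interval_of :: "real \<Rightarrow> real set" where
  "interval_of x = {x .. x + 1 / 2 ^ (2 * order_of x)}"

definition X_star :: "real set" where
  "X_star = {0..1} - (\<Union>x\<in>balanced_gen 1. interval_of x)"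

lemma balanced_of_order_less_False:
  assumes "balanced_of_order m x" and "balanced_of_order m' x" and "m < m'"
  shows False
proof -
  obtain k :: nat where k: "x = real k / 2 ^ (2 * m)" and Dm: "sign_sum (2 * m) x = 0"
    using assms(1) unfolding balanced_of_order_def by blast
  have Dm': "sign_sum (2 * m') x = 0"
    using assms(2) unfolding balanced_of_order_def by blast
  have digit: "bin_digit j x = 0" if j: "j \<in> {2 * m + 1..2 * m'}" for j
  proof -
    obtain d where d: "j = 2 * m + Suc d"
      using j less_imp_Suc_add[of "2 * m" j] by auto
    have "2 ^ j * x = real (2 ^ Suc d * k)"
      unfolding d k by (simp add: power_add)
    then have "nat \<lfloor>2 ^ j * x\<rfloor> = 2 ^ Suc d * k"
      by (metis floor_of_nat nat_int)
    then show ?thesis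
      by (simp add: bin_digit_def)
  qed
  have "{1..2 * m'} = {1..2 * m} \<union> {2 * m + 1..2 * m'}"
    using assms(3) by auto
  then have "sign_sum (2 * m') x = sign_sum (2 * m) x
      + (\<Sum>j = 2 * m + 1..2 * m'. (- 1) ^ bin_digit j x)"
    unfolding sign_sum_def by (simp add: sum.union_disjoint)
  also have "(\<Sum>j = 2 * m + 1..2 * m'. (- 1) ^ bin_digit j x) = (\<Sum>j = 2 * m + 1..2 * m'. 1 :: int)"
    by (rule sum.cong) (use digit in auto)
  finally show False
    using Dm Dm' assms(3) by simp
qed

lemma order_of_eq: "balanced_of_order m x \<Longrightarrow> order_of x = m"
  unfolding order_of_def
  by (rule the_equality) (use balanced_of_order_less_False nat_neq_iff in blast)+

end

theory Submission
  imports Defs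
begin

text \<open>
  Everything follows from the two functional equations \<open>T (w/2) = (w + T w) / 2\<close> and
  \<open>T ((1+w)/2) = (1 - w + T w) / 2\<close>, along which the walk \<open>D\<close> loses its first step.
  Points of \<open>X_star\<close> other than \<open>0\<close> and \<open>1\<close> are non-dyadic and their walk never returns
  to \<open>0\<close>. If the walk of \<open>v\<close> stays above \<open>- e\<close>, then \<open>T v \<le> e (1 - v)\<close>: unfolding one
  digit replaces \<open>e\<close> by \<open>e \<plusminus> 1\<close> and halves the error. For \<open>e = 1\<close> this and its
  mirror image give \<open>T \<le> 1/2\<close> on \<open>X_star\<close>. Comparing two points at their first
  differing digit, this bound gives strict monotonicity.

  For \<open>0 < y \<le> 1/2\<close>, let \<open>a\<close> be the supremum of the points \<open>t \<le> 1/2\<close> with \<open>T t < y\<close>, so that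
  \<open>T a = y\<close>. On a generation 1 interval \<open>T\<close> is a shrunken copy of itself, raised by its common
  value at the end points. So if \<open>a\<close> were in such an interval, it would be its left end
  point; but that is the right end point of another generation 1 interval, on which \<open>T \<ge> y\<close>,
  against the choice of \<open>a\<close>.
\<close>

section \<open>Distance to the nearest integer\<close>

lemma infdist_Ints_add:
  fixes x :: real
  assumes "m \<in> \<int>"
  shows "infdist (m + x) \<int> = infdist x \<int>"
proof -
  have "dist (m + x) ` \<int> = dist x ` \<int>"
  proof
    show "dist (m + x) ` \<int> \<subseteq> dist x ` \<int>"
    proof
      fix r assume "r \<in> dist (m + x) ` \<int>"
      then obtain a where "a \<in> \<int>" "r = dist (m + x) a" by blast
      then have "a - m \<in> \<int>" "r = dist x (a - m)"
        using assms by (auto simp: dist_real_def algebra_simps)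
      then show "r \<in> dist x ` \<int>" by blast
    qed
    show "dist x ` \<int> \<subseteq> dist (m + x) ` \<int>"
    proof
      fix r assume "r \<in> dist x ` \<int>"
      then obtain a where "a \<in> \<int>" "r = dist x a" by blast
      then have "m + a \<in> \<int>" "r = dist (m + x) (m + a)"
        using assms by (auto simp: dist_real_def)
      then show "r \<in> dist (m + x) ` \<int>" by blast
    qed
  qed
  moreover have "(\<int> :: real set) \<noteq> {}" using Ints_0 by blast
  ultimately show ?thesis by (simp add: infdist_def)
qed

lemma infdist_Ints_eq_self:
  fixes x :: real
  assumes "0 \<le> x" "x \<le> 1 / 2"
  shows "infdist x \<int> = x"
proof (rule antisym)
  show "infdist x \<int> \<le> x"
    using infdist_le[of "0 :: real" "\<int>" x] assms by simp
  have "x \<le> dist x a" if a: "a \<in> \<int>" for a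
  proof -
    obtain i :: int where i: "a = of_int i" using a by (rule Ints_cases)
    show ?thesis
    proof (cases "i \<le> 0")
      case True
      then have "a \<le> 0" by (simp add: i)
      then show ?thesis by (simp add: dist_real_def)
    next
      case False
      then have "a \<ge> 1" by (simp add: i)
      then show ?thesis using assms by (simp add: dist_real_def)
    qed
  qed
  moreover have "(\<int> :: real set) \<noteq> {}" using Ints_0 by blast
  ultimately show "x \<le> infdist x \<int>"
    unfolding infdist_def by (auto intro: cINF_greatest)
qed

lemma infdist_Ints_minus:
  fixes x :: real
  shows "infdist (- x) \<int> = infdist x \<int>"
proof -
  have "dist (- x) ` \<int> = dist x ` \<int>"
  proof -
    have "dist (- x) a = dist x (- a)" for a by (simp add: dist_real_def)
    moreover have "(\<int> :: real set) = uminus ` \<int>"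
      by (auto simp: image_iff) (metis Ints_minus minus_minus)
    ultimately show ?thesis by (metis (no_types, lifting) image_cong image_image)
  qed
  moreover have "(\<int> :: real set) \<noteq> {}" using Ints_0 by blast
  ultimately show ?thesis by (simp add: infdist_def)
qed

lemma infdist_Ints_eq_one_minus:
  fixes x :: real
  assumes "1 / 2 \<le> x" "x \<le> 1"
  shows "infdist x \<int> = 1 - x"
proof -
  have "infdist x \<int> = infdist (1 + - x) \<int>"
    by (subst infdist_Ints_add) (auto simp: infdist_Ints_minus)
  then show ?thesis using assms by (simp add: infdist_Ints_eq_self)
qed

lemma infdist_Ints_le_half:
  fixes x :: real
  shows "infdist x \<int> \<le> 1 / 2"
proof -
  have "infdist x \<int> = infdist (frac x) \<int>"
    using infdist_Ints_add[of "of_int \<lfloor>x\<rfloor>" "frac x"] by (simp add: frac_def)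
  moreover have "0 \<le> frac x" "frac x < 1" by (auto intro: frac_lt_1)
  ultimately show ?thesis
    using infdist_Ints_eq_self[of "frac x"] infdist_Ints_eq_one_minus[of "frac x"]
    by (cases "frac x \<le> 1 / 2") auto
qed

section \<open>The Takagi series and its functional equations\<close>

text \<open>One majorant serves for summability, for the uniform convergence behind continuity, and,
  because it sums to 1, for T \<le> 1.\<close>

lemma takagi_term_bound:
  fixes x :: real
  shows "norm ((1/2) ^ n * infdist (2 ^ n * x) \<int> :: real) \<le> (1/2) ^ Suc n"
  using infdist_Ints_le_half[of "2 ^ n * x"]
  by (simp add: infdist_nonneg abs_mult divide_simps)

lemma summable_takagi:
  fixes x :: real
  shows "summable (\<lambda>n. (1/2) ^ n * infdist (2 ^ n * x) \<int> :: real)"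
proof (rule summable_comparison_test')
  show "summable (\<lambda>n. (1/2) ^ Suc n :: real)"
    by (subst summable_Suc_iff) (simp add: summable_geometric)
qed (rule takagi_term_bound)

lemma takagi_nonneg: "0 \<le> takagi x"
  unfolding takagi_def by (intro suminf_nonneg summable_takagi) (simp add: infdist_nonneg)

text \<open>Crude (the maximum is 2/3), but it only starts inductions in which the error is halved
  at every digit.\<close>

lemma takagi_le_1: "takagi x \<le> 1"
proof -
  note s = power_half_series
  have "takagi x \<le> (\<Sum>n. (1/2) ^ Suc n :: real)"
    unfolding takagi_def
  proof (rule suminf_le)
    show "(1/2) ^ n * infdist (2 ^ n * x) \<int> \<le> (1/2) ^ Suc n" for n
      using takagi_term_bound[of n x] by (simp only: real_norm_def abs_le_D1)
    show "summable (\<lambda>n. (1/2) ^ Suc n :: real)" using s by (rule sums_summable)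
  qed (rule summable_takagi)
  also have "\<dots> = 1" using s by (rule sums_unique[symmetric])
  finally show ?thesis .
qed

lemma continuous_takagi: "continuous_on A takagi"
proof -
  have "uniform_limit A (\<lambda>n x. \<Sum>i<n. (1/2) ^ i * infdist (2 ^ i * x) \<int>)
          (\<lambda>x. \<Sum>i. (1/2) ^ i * infdist (2 ^ i * x) \<int> :: real) sequentially"
  proof (rule Weierstrass_m_test)
    show "summable (\<lambda>n. (1/2) ^ Suc n :: real)"
      by (subst summable_Suc_iff) (simp add: summable_geometric)
  qed (rule takagi_term_bound)
  then have "continuous_on A (\<lambda>x. \<Sum>i. (1/2) ^ i * infdist (2 ^ i * x) \<int> :: real)"
    by (rule uniform_limit_theorem[rotated])
      (auto intro!: always_eventually continuous_intros)
  then show ?thesis by (simp add: takagi_def[abs_def])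
qed

lemma takagi_rec: "takagi x = infdist x \<int> + takagi (2 * x) / 2"
proof -
  have "(\<Sum>n. (1/2) ^ Suc n * infdist (2 ^ Suc n * x) \<int>) = takagi (2 * x) / 2"
    unfolding takagi_def
    by (subst suminf_divide[OF summable_takagi, symmetric]) (simp add: mult_ac)
  then show ?thesis
    using suminf_split_head[OF summable_takagi[of x]] by (simp add: takagi_def)
qed

lemma takagi_one_plus: "takagi (1 + x) = takagi x"
  unfolding takagi_def
  by (intro suminf_cong) (simp add: infdist_Ints_add distrib_left)

lemma takagi_half:
  assumes "0 \<le> w" "w \<le> 1"
  shows "takagi (w / 2) = (w + takagi w) / 2"
  using takagi_rec[of "w / 2"] infdist_Ints_eq_self[of "w / 2"] assms by (simp add: add_divide_distrib)

lemma takagi_half_plus: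
  assumes "0 \<le> w" "w \<le> 1"
  shows "takagi ((1 + w) / 2) = (1 - w + takagi w) / 2"
proof -
  have "takagi ((1 + w) / 2) = infdist ((1 + w) / 2) \<int> + takagi (1 + w) / 2"
    using takagi_rec[of "(1 + w) / 2"]
    by (simp only: nonzero_mult_div_cancel_left times_divide_eq_right
        zero_neq_numeral not_False_eq_True)
  also have "infdist ((1 + w) / 2) \<int> = 1 - (1 + w) / 2"
    using assms by (intro infdist_Ints_eq_one_minus) auto
  finally show ?thesis by (simp add: takagi_one_plus field_simps)
qed

lemma takagi_0 [simp]: "takagi 0 = 0"
  using takagi_half[of 0] by simp

lemma takagi_1 [simp]: "takagi 1 = 0"
  using takagi_one_plus[of 0] by simp

section \<open>Binary expansions and the walk of their digits\<close>

lemma unit_interval_halves: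
  fixes x :: real
  assumes "0 \<le> x" "x < 1"
  obtains (low) w where "0 \<le> w" "w < 1" "x = w / 2"
  | (high) w where "0 \<le> w" "w < 1" "x = (1 + w) / 2"
proof (cases "x < 1 / 2")
  case True
  then show ?thesis using assms low[of "2 * x"] by simp
next
  case False
  then show ?thesis using assms high[of "2 * x - 1"] by simp
qed

lemma sign_sum_0 [simp]: "sign_sum 0 x = 0"
  by (simp add: sign_sum_def)

lemma sign_sum_Suc: "sign_sum (Suc j) x = sign_sum j x + (-1) ^ bin_digit (Suc j) x"
  by (simp add: sign_sum_def)

lemma sign_sum_Suc_cases:
  "sign_sum (Suc j) x = sign_sum j x + 1 \<or> sign_sum (Suc j) x = sign_sum j x - 1"
  by (cases "even (bin_digit (Suc j) x)") (auto simp: sign_sum_Suc)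

text \<open>Halving puts the digit 0 in front of the expansion of w: the walk steps up once and then
  follows that of w.\<close>

lemma sign_sum_half:
  assumes "0 \<le> w" "w < 1"
  shows "sign_sum (Suc j) (w / 2) = 1 + sign_sum j w"
proof (induction j)
  case 0
  have "\<lfloor>w\<rfloor> = 0" using assms by linarith
  then show ?case by (simp add: sign_sum_Suc bin_digit_def)
next
  case (Suc j)
  have "bin_digit (Suc (Suc j)) (w / 2) = bin_digit (Suc j) w"
    by (simp add: bin_digit_def mult_ac)
  then show ?case using Suc by (simp add: sign_sum_Suc[of "Suc j"] sign_sum_Suc[of j w])
qed

lemma sign_sum_half_plus:
  assumes "0 \<le> w" "w < 1"
  shows "sign_sum (Suc j) ((1 + w) / 2) = sign_sum j w - 1"
proof (induction j)
  case 0
  have "\<lfloor>2 ^ Suc 0 * ((1 + w) / 2)\<rfloor> = \<lfloor>1 + w\<rfloor>"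
    by (rule arg_cong[where f = floor]) (simp add: field_simps)
  also have "\<dots> = 1" using assms by linarith
  finally have "bin_digit (Suc 0) ((1 + w) / 2) = 1" by (simp only: bin_digit_def) simp
  then show ?case by (simp add: sign_sum_Suc)
next
  case (Suc j)
  have "2 ^ Suc (Suc j) * ((1 + w) / 2) = 2 ^ Suc j * w + of_int (2 ^ Suc j)"
    by (simp add: algebra_simps)
  then have "\<lfloor>2 ^ Suc (Suc j) * ((1 + w) / 2)\<rfloor> = \<lfloor>2 ^ Suc j * w\<rfloor> + 2 ^ Suc j"
    by (metis floor_add_int)
  moreover have "0 \<le> \<lfloor>2 ^ Suc j * w\<rfloor>" using assms by simp
  \<comment> \<open>The prefixed digit 1 adds an even number here, so it leaves the parity, and
    hence this digit, unchanged.\<close>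
  ultimately have "nat \<lfloor>2 ^ Suc (Suc j) * ((1 + w) / 2)\<rfloor> = nat \<lfloor>2 ^ Suc j * w\<rfloor> + 2 * 2 ^ j"
    by (simp add: nat_add_distrib nat_mult_distrib nat_power_eq)
  then have "bin_digit (Suc (Suc j)) ((1 + w) / 2) = bin_digit (Suc j) w"
    unfolding bin_digit_def by simp
  then show ?case using Suc by (simp add: sign_sum_Suc[of "Suc j"] sign_sum_Suc[of j w])
qed

lemma even_sign_sum_iff: "even (sign_sum j x) \<longleftrightarrow> even j"
  by (induction j) (auto simp: sign_sum_Suc)

section \<open>Affine self-similarity over dyadic intervals\<close>

text \<open>On a dyadic interval of level n the first n terms of the series are linear with slope
  D_n, and the remaining ones form a copy of T scaled by 2^-n. The induction removes the leading
  digit by the functional equations. Where D_n = 0, only the raised copy remains.\<close>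

lemma takagi_dyadic_affine:
  fixes k :: nat
  assumes "k < 2 ^ n" "0 \<le> h" "h \<le> 1"
  shows "takagi (real k / 2 ^ n + h / 2 ^ n) =
    takagi (real k / 2 ^ n) + (takagi h + of_int (sign_sum n (real k / 2 ^ n)) * h) / 2 ^ n"
  using assms(1)
proof (induction n arbitrary: k)
  case 0
  then show ?case by simp
next
  case (Suc n)
  \<comment> \<open>The numerator after deletion of the leading binary digit of k.\<close>
  define l where "l = (if k < 2 ^ n then k else k - 2 ^ n)"
  define w where "w = real l / 2 ^ n"
  have l: "l < 2 ^ n" using Suc.prems by (auto simp: l_def)
  then have "real l < 2 ^ n" by (metis of_nat_less_iff of_nat_numeral of_nat_power)
  then have w: "0 \<le> w" "w < 1" by (auto simp: w_def)
  have "real l + h \<le> 2 ^ n"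
  proof -
    have "real l + 1 \<le> 2 ^ n"
      using l by (metis Suc_leI of_nat_Suc of_nat_le_iff of_nat_numeral of_nat_power add.commute)
    then show ?thesis using assms by simp
  qed
  then have wh: "0 \<le> w + h / 2 ^ n" "w + h / 2 ^ n \<le> 1"
    using assms w by (auto simp: w_def field_simps)
  note IH = Suc.IH[OF l, folded w_def]
  show ?case
  proof (cases "k < 2 ^ n")
    case True
    then have k: "real k / 2 ^ Suc n = w / 2" by (simp add: w_def l_def)
    have "takagi ((w + h / 2 ^ n) / 2) = (w + h / 2 ^ n + takagi (w + h / 2 ^ n)) / 2"
      using wh by (rule takagi_half)
    moreover have "real k / 2 ^ Suc n + h / 2 ^ Suc n = (w + h / 2 ^ n) / 2"
      unfolding k by simp
    ultimately have "takagi (real k / 2 ^ Suc n + h / 2 ^ Suc n) =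
        (w + h / 2 ^ n + (takagi w + (takagi h + of_int (sign_sum n w) * h) / 2 ^ n)) / 2"
      by (simp only: IH)
    moreover have "takagi (real k / 2 ^ Suc n) = (w + takagi w) / 2"
      unfolding k using w by (intro takagi_half) auto
    moreover have "sign_sum (Suc n) (real k / 2 ^ Suc n) = 1 + sign_sum n w"
      unfolding k using w by (rule sign_sum_half)
    ultimately show ?thesis
      by (simp only:) (simp add: field_simps)
  next
    case False
    then have k: "real k / 2 ^ Suc n = (1 + w) / 2" by (simp add: w_def l_def field_simps of_nat_diff)
    have "takagi ((1 + (w + h / 2 ^ n)) / 2) = (1 - (w + h / 2 ^ n) + takagi (w + h / 2 ^ n)) / 2"
      using wh by (rule takagi_half_plus)
    moreover have "real k / 2 ^ Suc n + h / 2 ^ Suc n = (1 + (w + h / 2 ^ n)) / 2"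
      unfolding k by simp
    ultimately have "takagi (real k / 2 ^ Suc n + h / 2 ^ Suc n) =
        (1 - (w + h / 2 ^ n) + (takagi w + (takagi h + of_int (sign_sum n w) * h) / 2 ^ n)) / 2"
      by (simp only: IH)
    moreover have "takagi (real k / 2 ^ Suc n) = (1 - w + takagi w) / 2"
      unfolding k using w by (intro takagi_half_plus) auto
    moreover have "sign_sum (Suc n) (real k / 2 ^ Suc n) = sign_sum n w - 1"
      unfolding k using w by (rule sign_sum_half_plus)
    ultimately show ?thesis
      by (simp only:) (simp add: field_simps)
  qed
qed

section \<open>Upper bounds from one-sided walks\<close>

text \<open>With leading digit 1 the bound for e - 1 at w turns exactly into the one for e at v.
  With leading digit 0 the bound for e + 1 leaves the slack (e - 1)/2, which is where 1 \<le> e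
  enters.\<close>

lemma takagi_le_one_minus_approx:
  fixes e :: int
  assumes "0 \<le> v" "v < 1" "1 \<le> e" "\<And>j. j \<le> n \<Longrightarrow> - e < sign_sum j v"
  shows "takagi v \<le> of_int e * (1 - v) + 1 / 2 ^ n"
  using assms
proof (induction n arbitrary: v e)
  case 0
  then have "0 \<le> of_int e * (1 - v)" by simp
  then show ?case using takagi_le_1[of v] by simp
next
  case (Suc n)
  from Suc.prems(1,2) show ?case
  proof (cases rule: unit_interval_halves)
    case (low w)
    have "- (e + 1) < sign_sum j w" if "j \<le> n" for j
      using Suc.prems(4)[of "Suc j"] that low sign_sum_half[of w j] by simp
    then have "takagi w \<le> of_int (e + 1) * (1 - w) + 1 / 2 ^ n"
      using Suc.IH[of w "e + 1"] low Suc.prems(3) by simp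
    moreover have "1 \<le> real_of_int e" using Suc.prems(3) by simp
    ultimately show ?thesis
      unfolding low(3) takagi_half[OF low(1) less_imp_le[OF low(2)]] by (simp add: algebra_simps add_divide_distrib)
  next
    case (high w)
    have "- (e - 1) < sign_sum j w" if "j \<le> n" for j
      using Suc.prems(4)[of "Suc j"] that high sign_sum_half_plus[of w j] by simp
    \<comment> \<open>After a first step down the walk is at -1, so staying above -e forces e \<ge>
      2.\<close>
    moreover from this[of 0] have "1 \<le> e - 1" by simp
    ultimately have "takagi w \<le> of_int (e - 1) * (1 - w) + 1 / 2 ^ n"
      using Suc.IH[of w "e - 1"] high by simp
    then show ?thesis
      unfolding high(3) takagi_half_plus[OF high(1) less_imp_le[OF high(2)]] by (simp add: field_simps)
  qed
qed

text \<open>Mirror image under v \<mapsto> 1 - v, which reverses the walk: now the digit 0 is the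
  exact case and the digit 1 the one with slack.\<close>

lemma takagi_le_self_approx:
  fixes e :: int
  assumes "0 \<le> v" "v < 1" "1 \<le> e" "\<And>j. j \<le> n \<Longrightarrow> sign_sum j v < e"
  shows "takagi v \<le> of_int e * v + 1 / 2 ^ n"
  using assms
proof (induction n arbitrary: v e)
  case 0
  then have "0 \<le> of_int e * v" by simp
  then show ?case using takagi_le_1[of v] by simp
next
  case (Suc n)
  from Suc.prems(1,2) show ?case
  proof (cases rule: unit_interval_halves)
    case (low w)
    have "sign_sum j w < e - 1" if "j \<le> n" for j
      using Suc.prems(4)[of "Suc j"] that low sign_sum_half[of w j] by simp
    moreover from this[of 0] have "1 \<le> e - 1" by simp
    ultimately have "takagi w \<le> of_int (e - 1) * w + 1 / 2 ^ n"
      using Suc.IH[of w "e - 1"] low by simp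
    then show ?thesis
      unfolding low(3) takagi_half[OF low(1) less_imp_le[OF low(2)]] by (simp add: field_simps)
  next
    case (high w)
    have "sign_sum j w < e + 1" if "j \<le> n" for j
      using Suc.prems(4)[of "Suc j"] that high sign_sum_half_plus[of w j] by simp
    then have "takagi w \<le> of_int (e + 1) * w + 1 / 2 ^ n"
      using Suc.IH[of w "e + 1"] high Suc.prems(3) by simp
    moreover have "1 \<le> real_of_int e" using Suc.prems(3) by simp
    ultimately show ?thesis
      using high(2) unfolding high(3) takagi_half_plus[OF high(1) less_imp_le[OF high(2)]]
      by (simp add: algebra_simps add_divide_distrib diff_divide_distrib)
  qed
qed

lemma le_if_le_add_half_powers:
  fixes a b :: real
  assumes "\<And>n :: nat. a \<le> b + 1 / 2 ^ n"
  shows "a \<le> b"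
proof (rule field_le_epsilon)
  fix r :: real assume "0 < r"
  then obtain n where "(1 / 2) ^ n < r" using real_arch_pow_inv[of r "1 / 2"] by auto
  then show "a \<le> b + r" using assms[of n] by (simp add: power_one_over)
qed

lemma takagi_le_one_minus:
  fixes e :: int
  assumes "0 \<le> v" "v < 1" "1 \<le> e" "\<And>j. - e < sign_sum j v"
  shows "takagi v \<le> of_int e * (1 - v)"
  by (rule le_if_le_add_half_powers) (rule takagi_le_one_minus_approx[OF assms])

lemma takagi_le_self:
  fixes e :: int
  assumes "0 \<le> v" "v < 1" "1 \<le> e" "\<And>j. sign_sum j v < e"
  shows "takagi v \<le> of_int e * v"
  by (rule le_if_le_add_half_powers) (rule takagi_le_self_approx[OF assms])

section \<open>Strict monotonicity along one-sided walks\<close>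

text \<open>The term d x makes the claim stable under removal of a common leading digit: up to a
  constant and a factor 1/2, T x + d x becomes the same expression with d + 1 (digit 0) or d - 1
  (digit 1). Only the first differing digit needs an estimate.\<close>

lemma takagi_plus_linear_less:
  fixes d :: int
  assumes "0 \<le> x" "x < y" "y < 1" "1 \<le> d"
    and "\<And>j. - d < sign_sum j x" "\<And>j. - d < sign_sum j y"
    and "\<And>i. 2 ^ i * y \<notin> \<int>"
  shows "takagi x + of_int d * x < takagi y + of_int d * y"
proof -
  \<comment> \<open>Removing a common digit doubles the gap y - x. After n removals it would exceed
    1, so n bounds the number of common digits.\<close>
  obtain n where "(1 / 2) ^ n < y - x"
    using assms(2) real_arch_pow_inv[of "y - x" "1 / 2"] by auto
  then have "1 / 2 ^ n < y - x" by (simp add: power_one_over)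
  then show ?thesis using assms
  proof (induction n arbitrary: x y d)
    case 0
    then show ?case by simp
  next
    case (Suc n)
    have "0 \<le> y" "x < 1" using Suc.prems by auto
    from \<open>0 \<le> x\<close> \<open>x < 1\<close> show ?case
    proof (cases rule: unit_interval_halves)
      case (low v)
      note v = this
      have dv: "- (d + 1) < sign_sum j v" for j
        using Suc.prems(6)[of "Suc j"] v sign_sum_half[of v j] by simp
      from \<open>0 \<le> y\<close> \<open>y < 1\<close> show ?thesis
      proof (cases rule: unit_interval_halves)
        case (low w)
        have dw: "- (d + 1) < sign_sum j w" for j
          using Suc.prems(7)[of "Suc j"] low sign_sum_half[of w j] by simp
        have "2 ^ i * w \<notin> \<int>" for i
          using Suc.prems(8)[of "Suc i"] low by simp
        moreover have "1 / 2 ^ n < w - v" "v < w"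
          using Suc.prems(1,3) v(3) low(3) by (simp_all add: field_simps)
        ultimately have "takagi v + of_int (d + 1) * v < takagi w + of_int (d + 1) * w"
          using Suc.prems(5) v(1) low(2) dv dw by (intro Suc.IH) auto
        then show ?thesis
          unfolding v(3) low(3) takagi_half[OF v(1) less_imp_le[OF v(2)]]
            takagi_half[OF low(1) less_imp_le[OF low(2)]] by (simp add: field_simps)
      next
        case (high w)
        \<comment> \<open>The digits differ here. The bound on T v gives at most (d + 1)/2 on the
          left, while the right side is (d + 1 + (d - 1) w + T w)/2. Strictness comes from d \<ge>
          2, as the walk of y starts with a step down, and from w > 0, as y is not 1/2.\<close>
        have d: "2 \<le> d"
          using Suc.prems(7)[of "Suc 0"] high sign_sum_half_plus[of w 0] by simp
        have "w \<noteq> 0" using Suc.prems(8)[of 1] high by auto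
        then have "0 < of_int (d - 1) * w" using high d by simp
        moreover have "takagi v \<le> of_int (d + 1) * (1 - v)"
          using takagi_le_one_minus[of v "d + 1"] v dv Suc.prems(5) by simp
        ultimately show ?thesis
          unfolding v(3) high(3) takagi_half[OF v(1) less_imp_le[OF v(2)]]
            takagi_half_plus[OF high(1) less_imp_le[OF high(2)]] using takagi_nonneg[of w] by (simp add: field_simps)
      qed
    next
      case (high v)
      note v = this
      have dv: "- (d - 1) < sign_sum j v" for j
        using Suc.prems(6)[of "Suc j"] v sign_sum_half_plus[of v j] by simp
      from \<open>0 \<le> y\<close> \<open>y < 1\<close> show ?thesis
      proof (cases rule: unit_interval_halves)
        case (low w)
        then show ?thesis using v Suc.prems(3) by simp
      next
        case (high w)
        have dw: "- (d - 1) < sign_sum j w" for j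
          using Suc.prems(7)[of "Suc j"] high sign_sum_half_plus[of w j] by simp
        have "2 ^ i * w \<notin> \<int>" for i
        proof
          assume "2 ^ i * w \<in> \<int>"
          then have "2 ^ i + 2 ^ i * w \<in> \<int>" by simp
          moreover have "2 ^ i + 2 ^ i * w = 2 ^ Suc i * y"
            unfolding high(3) by (simp add: field_simps)
          ultimately show False
            using Suc.prems(8)[of "Suc i"] by simp
        qed
        moreover have "1 \<le> d - 1" using dv[of 0] by simp
        moreover have "1 / 2 ^ n < w - v" "v < w"
          using Suc.prems(1,3) v(3) high(3) by (simp_all add: field_simps)
        ultimately have "takagi v + of_int (d - 1) * v < takagi w + of_int (d - 1) * w"
          using v(1) high(2) dv dw by (intro Suc.IH) auto
        then show ?thesis
          unfolding v(3) high(3) takagi_half_plus[OF v(1) less_imp_le[OF v(2)]]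
            takagi_half_plus[OF high(1) less_imp_le[OF high(2)]] by (simp add: field_simps)
      qed
    qed
  qed
qed

section \<open>First returns of the walk and the set \<open>X_star\<close>\<close>

text \<open>This is generation 1 with the level n = 2 m as an explicit argument in place of
  \<open>order_of\<close>. Evenness of n is automatic, since a walk with steps 1 and -1 is at 0 only
  at even times.\<close>

definition first_return :: "nat \<Rightarrow> real \<Rightarrow> bool" where
  "first_return n x \<longleftrightarrow> 1 \<le> n \<and> (\<exists>k::nat. k < 2 ^ n \<and> x = real k / 2 ^ n) \<and>
     sign_sum n x = 0 \<and> (\<forall>j\<in>{1..<n}. sign_sum j x \<noteq> 0)"

lemma balanced_gen_1_imp_first_return:
  assumes "x \<in> balanced_gen 1"
  shows "first_return (2 * order_of x) x"
proof -
  obtain m where b: "balanced_of_order m x"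
    using assms by (auto simp: balanced_gen_def balanced_def)
  then have m: "order_of x = m" by (rule order_of_eq)
  have 1: "1 \<le> m" and 0: "sign_sum (2 * m) x = 0"
    using b by (auto simp: balanced_of_order_def)
  have "card {j \<in> {1..2 * m}. sign_sum j x = 0} = 1"
    using assms by (simp add: balanced_gen_def generation_def m)
  then obtain i where i: "{j \<in> {1..2 * m}. sign_sum j x = 0} = {i}"
    by (rule card_1_singletonE)
  have "2 * m \<in> {j \<in> {1..2 * m}. sign_sum j x = 0}" using 0 1 by simp
  then have "sign_sum j x \<noteq> 0" if "j \<in> {1..<2 * m}" for j
    using that i by (metis (mono_tags, lifting) atLeastAtMost_iff atLeastLessThan_iff
        less_imp_le mem_Collect_eq nat_neq_iff singletonD)
  then show ?thesis using b 1 by (auto simp: first_return_def m balanced_of_order_def)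
qed

lemma first_return_imp_balanced_gen_1:
  assumes "first_return n x"
  shows "x \<in> balanced_gen 1" "interval_of x = {x..x + 1 / 2 ^ n}"
proof -
  have "even n" using assms even_sign_sum_iff[of n x] by (simp add: first_return_def)
  then obtain m where n: "n = 2 * m" by (elim evenE)
  have b: "balanced_of_order m x"
    using assms by (auto simp: first_return_def balanced_of_order_def n)
  then have m: "order_of x = m" by (rule order_of_eq)
  then show "interval_of x = {x..x + 1 / 2 ^ n}" by (simp add: interval_of_def n)
  have "{j \<in> {1..2 * m}. sign_sum j x = 0} = {n}"
    using assms by (force simp: first_return_def n)
  then show "x \<in> balanced_gen 1"
    using b by (auto simp: balanced_gen_def balanced_def generation_def m)
qed

lemma X_star_iff:
  "x \<in> X_star \<longleftrightarrow> x \<in> {0..1} \<and> (\<forall>n z. first_return n z \<longrightarrow> x \<notin> {z..z + 1 / 2 ^ n})"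
proof -
  have "(\<Union>z\<in>balanced_gen 1. interval_of z) = {x. \<exists>n z. first_return n z \<and> x \<in> {z..z + 1 / 2 ^ n}}"
    (is "?L = ?R")
  proof
    show "?L \<subseteq> ?R"
      using balanced_gen_1_imp_first_return first_return_imp_balanced_gen_1(2) by blast
    show "?R \<subseteq> ?L"
      using first_return_imp_balanced_gen_1 by blast
  qed
  then show ?thesis unfolding X_star_def by blast
qed

text \<open>Cutting the expansion of x after n digits gives the left end point of a level n interval
  around x and keeps the first n steps of the walk.\<close>

lemma dyadic_truncation:
  assumes "0 \<le> x" "x < 1"
  obtains k :: nat where "k < 2 ^ n" "x \<in> {real k / 2 ^ n..real k / 2 ^ n + 1 / 2 ^ n}"
    "\<And>j. j \<le> n \<Longrightarrow> sign_sum j (real k / 2 ^ n) = sign_sum j x"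
proof -
  have "\<exists>k::nat. k < 2 ^ n \<and> x \<in> {real k / 2 ^ n..real k / 2 ^ n + 1 / 2 ^ n} \<and>
    (\<forall>j\<le>n. sign_sum j (real k / 2 ^ n) = sign_sum j x)"
    using assms
  proof (induction n arbitrary: x)
    case 0
    then show ?case by (intro exI[of _ 0]) simp
  next
    case (Suc n)
    from Suc.prems show ?case
    proof (cases rule: unit_interval_halves)
      case (low w)
      with Suc.IH[of w] obtain k :: nat where k: "k < 2 ^ n"
        "w \<in> {real k / 2 ^ n..real k / 2 ^ n + 1 / 2 ^ n}"
        "\<forall>j\<le>n. sign_sum j (real k / 2 ^ n) = sign_sum j w" by blast
      have r: "real k / 2 ^ n < 1" using k(1) by (simp add: of_nat_less_numeral_power_cancel_iff)
      have "sign_sum j (real k / 2 ^ Suc n) = sign_sum j x" if "j \<le> Suc n" for j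
      proof (cases j)
        case (Suc i)
        then show ?thesis
          using sign_sum_half[of "real k / 2 ^ n" i] sign_sum_half[of w i] low r k(3) that
          unfolding low(3) by (simp add: mult.commute)
      qed simp
      then show ?thesis using k(1,2) low by (intro exI[of _ k]) (auto simp: field_simps)
    next
      case (high w)
      with Suc.IH[of w] obtain k :: nat where k: "k < 2 ^ n"
        "w \<in> {real k / 2 ^ n..real k / 2 ^ n + 1 / 2 ^ n}"
        "\<forall>j\<le>n. sign_sum j (real k / 2 ^ n) = sign_sum j w" by blast
      have r: "real k / 2 ^ n < 1" using k(1) by (simp add: of_nat_less_numeral_power_cancel_iff)
      have e: "real (2 ^ n + k) / 2 ^ Suc n = (1 + real k / 2 ^ n) / 2" by (simp add: field_simps)
      have "sign_sum j (real (2 ^ n + k) / 2 ^ Suc n) = sign_sum j x" if "j \<le> Suc n" for j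
      proof (cases j)
        case (Suc i)
        then show ?thesis
          unfolding e high(3)
          using sign_sum_half_plus[of "real k / 2 ^ n" i] sign_sum_half_plus[of w i] high r k(3) that
          by simp
      qed simp
      then show ?thesis using k(1,2) unfolding high(3)
        by (intro exI[of _ "2 ^ n + k"]) (auto simp: field_simps)
    qed
  qed
  then show ?thesis using that by blast
qed

text \<open>If the walk returned to 0, first at time n, the truncation of x to n digits would be a
  generation 1 point whose interval contains x.\<close>

lemma X_star_sign_sum_nonzero:
  assumes "x \<in> X_star" "x < 1" "1 \<le> j"
  shows "sign_sum j x \<noteq> 0"
proof
  assume "sign_sum j x = 0"
  define n where "n = (LEAST j. 1 \<le> j \<and> sign_sum j x = 0)"
  have n: "1 \<le> n" "sign_sum n x = 0"
    using LeastI[of "\<lambda>j. 1 \<le> j \<and> sign_sum j x = 0" j] \<open>sign_sum j x = 0\<close> assms(3)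
    by (auto simp: n_def)
  have less: "sign_sum i x \<noteq> 0" if "i \<in> {1..<n}" for i
    using not_less_Least[of i "\<lambda>j. 1 \<le> j \<and> sign_sum j x = 0"] that by (auto simp: n_def)
  have "0 \<le> x" using assms(1) by (simp add: X_star_iff)
  then obtain k :: nat where k: "k < 2 ^ n" "x \<in> {real k / 2 ^ n..real k / 2 ^ n + 1 / 2 ^ n}"
    "\<And>j. j \<le> n \<Longrightarrow> sign_sum j (real k / 2 ^ n) = sign_sum j x"
    using dyadic_truncation[of x n] assms(2) by blast
  then have "first_return n (real k / 2 ^ n)"
    using n less by (auto simp: first_return_def)
  then show False using assms(1) k(2) by (auto simp: X_star_iff)
qed

text \<open>The first step goes up, and a walk with steps 1 and -1 cannot change sign without
  visiting 0.\<close>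

lemma sign_sum_pos:
  assumes "0 \<le> x" "x < 1 / 2" "\<And>i. i \<in> {1..j} \<Longrightarrow> sign_sum i x \<noteq> 0" "1 \<le> j"
  shows "0 < sign_sum j x"
  using assms(4,3)
proof (induction j rule: dec_induct)
  case base
  then show ?case using sign_sum_half[of "2 * x" 0] assms(1,2) by simp
next
  case (step j)
  have "sign_sum (Suc j) x \<noteq> 0" using step.prems by simp
  moreover have "0 < sign_sum j x" using step.IH step.prems by simp
  ultimately show ?case using sign_sum_Suc_cases[of j x] by linarith
qed

lemma sign_sum_neg:
  assumes "1 / 2 \<le> x" "x < 1" "\<And>i. i \<in> {1..j} \<Longrightarrow> sign_sum i x \<noteq> 0" "1 \<le> j"
  shows "sign_sum j x < 0"
  using assms(4,3)
proof (induction j rule: dec_induct)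
  case base
  then show ?case using sign_sum_half_plus[of "2 * x - 1" 0] assms(1,2) by simp
next
  case (step j)
  have "sign_sum (Suc j) x \<noteq> 0" using step.prems by simp
  moreover have "sign_sum j x < 0" using step.IH step.prems by simp
  ultimately show ?case using sign_sum_Suc_cases[of j x] by linarith
qed

section \<open>Dyadic points as right end points of generation 1 intervals\<close>

lemma sign_sum_one_minus_power: "j \<le> n \<Longrightarrow> sign_sum j (1 - 1 / 2 ^ n) = - int j"
proof (induction n arbitrary: j)
  case (Suc n)
  show ?case
  proof (cases j)
    case (Suc i)
    have "1 - 1 / 2 ^ Suc n = (1 + (1 - 1 / 2 ^ n)) / (2 :: real)" by (simp add: field_simps)
    then have "sign_sum (Suc i) (1 - 1 / 2 ^ Suc n) = sign_sum i (1 - 1 / 2 ^ n) - 1"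
      using sign_sum_half_plus[of "1 - 1 / 2 ^ n" i] by (simp only:) simp
    then show ?thesis
      using Suc.IH[of i] Suc Suc.prems by simp
  qed simp
qed simp

text \<open>The point is obtained from the finite binary expansion of \<open>z\<close> by replacing its last
  block \<open>1000\<dots>\<close> by \<open>0111\<dots>\<close> up to the first passage of the walk through \<open>- e\<close>.\<close>

lemma dyadic_left_neighbour:
  fixes z :: real and k :: nat and e :: int
  assumes "0 < z" "z < 1" "z = real k / 2 ^ n" "1 \<le> e" "\<And>j. j < n \<Longrightarrow> - e < sign_sum j z"
  shows "\<exists>m l::nat. z = real (Suc l) / 2 ^ m \<and> sign_sum m (real l / 2 ^ m) = - e \<and>
    (\<forall>j<m. - e < sign_sum j (real l / 2 ^ m))"
  using assms
proof (induction n arbitrary: z k e)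
  case 0
  then show ?case by simp
next
  case (Suc n)
  from less_imp_le[OF Suc.prems(1)] Suc.prems(2) show ?case
  proof (cases rule: unit_interval_halves)
    case (low w)
    have "- (e + 1) < sign_sum j w" if "j < n" for j
      using Suc.prems(5)[of "Suc j"] that low sign_sum_half[of w j] by simp
    then obtain m l where ml: "w = real (Suc l) / 2 ^ m" "sign_sum m (real l / 2 ^ m) = - (e + 1)"
      "\<forall>j<m. - (e + 1) < sign_sum j (real l / 2 ^ m)"
      using Suc.IH[of w k "e + 1"] low Suc.prems by auto
    have "real l / 2 ^ m \<le> real (Suc l) / 2 ^ m" by (simp add: divide_right_mono)
    then have r: "real l / 2 ^ m < 1" "real l / 2 ^ Suc m = real l / 2 ^ m / 2"
      using ml(1) low(2) by linarith simp
    have S: "sign_sum (Suc j) (real l / 2 ^ Suc m) = 1 + sign_sum j (real l / 2 ^ m)" for j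
      using sign_sum_half[of "real l / 2 ^ m" j] r by (simp add: mult.commute)
    have "- e < sign_sum j (real l / 2 ^ Suc m)" if "j < Suc m" for j
      using that ml(3) S Suc.prems(4) by (cases j) force+
    then show ?thesis
      using ml low S by (intro exI[of _ "Suc m"] exI[of _ l]) simp
  next
    case (high w)
    show ?thesis
    proof (cases "w = 0")
      case True
      \<comment> \<open>Here z = 1/2, and its left neighbour is 0 followed by m ones. The walk ends
        at 1 - m, which must be -e.\<close>
      define m where "m = nat e + 1"
      define l :: nat where "l = 2 ^ m - 1"
      have l: "real l / 2 ^ Suc m = (1 - 1 / 2 ^ m) / 2"
        by (simp add: l_def field_simps of_nat_diff)
      have S: "sign_sum (Suc j) (real l / 2 ^ Suc m) = 1 - int j" if "j \<le> m" for j
        unfolding l using that sign_sum_half[of "1 - 1 / 2 ^ m" j]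
          sign_sum_one_minus_power[of j m] by simp
      have "- e < sign_sum j (real l / 2 ^ Suc m)" if "j < Suc m" for j
      proof (cases j)
        case 0
        then show ?thesis using Suc.prems(4) by simp
      next
        case (Suc i)
        then have "i < m" using that by simp
        then show ?thesis using S[of i] \<open>1 \<le> e\<close> Suc by (simp add: m_def)
      qed
      moreover have "sign_sum (Suc m) (real l / 2 ^ Suc m) = - e"
        using S[of m] \<open>1 \<le> e\<close> by (simp add: m_def)
      moreover have "z = real (Suc l) / 2 ^ Suc m"
        using high True by (simp add: l_def of_nat_diff)
      ultimately show ?thesis by blast
    next
      case False
      have "real k = 2 ^ n * (1 + w)"
        using Suc.prems(3) high(3) by (simp add: field_simps)
      then have "real k = real (2 ^ n) + 2 ^ n * w"
        by (simp add: algebra_simps)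
      moreover from this have "2 ^ n \<le> k"
        using high(1) by (metis le_add_same_cancel1 mult_nonneg_nonneg of_nat_le_iff
            zero_le_numeral zero_le_power)
      ultimately have w: "w = real (k - 2 ^ n) / 2 ^ n"
        by (simp add: of_nat_diff)
      \<comment> \<open>For n = 0 the number w would be an integer in [0, 1), hence 0. With n > 0
        the hypothesis covers time 1 of the walk of z, giving e \<ge> 2.\<close>
      have "0 < n"
      proof (rule ccontr)
        assume "\<not> 0 < n"
        then show False using w high(1,2) False by simp
      qed
      have "- (e - 1) < sign_sum j w" if "j < n" for j
        using Suc.prems(5)[of "Suc j"] that high sign_sum_half_plus[of w j] by simp
      moreover from this[of 0] have "1 \<le> e - 1" using \<open>0 < n\<close> by simp
      ultimately obtain m l where ml: "w = real (Suc l) / 2 ^ m"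
        "sign_sum m (real l / 2 ^ m) = - (e - 1)"
        "\<forall>j<m. - (e - 1) < sign_sum j (real l / 2 ^ m)"
        using Suc.IH[of w "k - 2 ^ n" "e - 1"] w high False by auto
      have "real l / 2 ^ m \<le> real (Suc l) / 2 ^ m" by (simp add: divide_right_mono)
      then have r: "real l / 2 ^ m < 1" "real (2 ^ m + l) / 2 ^ Suc m = (1 + real l / 2 ^ m) / 2"
        using ml(1) high(2) by linarith (simp add: field_simps)
      have S: "sign_sum (Suc j) (real (2 ^ m + l) / 2 ^ Suc m) = sign_sum j (real l / 2 ^ m) - 1" for j
        unfolding r(2) using sign_sum_half_plus[of "real l / 2 ^ m" j] r by simp
      have "- e < sign_sum j (real (2 ^ m + l) / 2 ^ Suc m)" if "j < Suc m" for j
        using that ml(3) S Suc.prems(4) by (cases j) force+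
      moreover have "sign_sum (Suc m) (real (2 ^ m + l) / 2 ^ Suc m) = - e"
        using S[of m] ml(2) by simp
      moreover have "z = real (Suc (2 ^ m + l)) / 2 ^ Suc m"
        unfolding high(3) ml(1) by (simp add: field_simps)
      ultimately show ?thesis by blast
    qed
  qed
qed

text \<open>Dropping the initial step up turns positivity into staying above -1. The left neighbour
  of 2 z for e = 1, with a digit 0 put in front, then returns to 0 for the first time at its last
  digit. Time n is excluded from the hypothesis, so z may itself be a first return.\<close>

lemma right_end_of_first_return:
  fixes z :: real and k :: nat
  assumes "0 < z" "z < 1 / 2" "z = real k / 2 ^ n" "\<And>j. j \<in> {1..<n} \<Longrightarrow> 0 < sign_sum j z"
  obtains m x where "first_return m x" "z = x + 1 / 2 ^ m"
proof -
  obtain n' where n: "n = Suc n'" using assms(1-3) by (cases n) auto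
  have S: "sign_sum (Suc j) z = 1 + sign_sum j (2 * z)" for j
    using sign_sum_half[of "2 * z" j] assms by simp
  have "- 1 < sign_sum j (2 * z)" if "j < n'" for j
    using assms(4)[of "Suc j"] S[of j] that n by simp
  then obtain m l where ml: "2 * z = real (Suc l) / 2 ^ m" "sign_sum m (real l / 2 ^ m) = - 1"
      "\<forall>j<m. - 1 < sign_sum j (real l / 2 ^ m)"
    using dyadic_left_neighbour[of "2 * z" k n' 1] assms n by auto
  have "real l / 2 ^ m \<le> real (Suc l) / 2 ^ m" by (simp add: divide_right_mono)
  then have "real l / 2 ^ m < 1" using ml(1) assms(2) by linarith
  then have l: "real l < 2 ^ m" by (simp add: divide_less_eq)
  have T: "sign_sum (Suc j) (real l / 2 ^ Suc m) = 1 + sign_sum j (real l / 2 ^ m)" for j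
    using sign_sum_half[of "real l / 2 ^ m" j] l by (simp add: mult.commute)
  have "sign_sum j (real l / 2 ^ Suc m) \<noteq> 0" if "j \<in> {1..<Suc m}" for j
    using that T ml(3) by (cases j) force+
  moreover have "l < 2 ^ Suc m"
  proof -
    have "l < 2 ^ m" using l by simp
    then show ?thesis by simp
  qed
  ultimately have "first_return (Suc m) (real l / 2 ^ Suc m)"
    using T[of m] ml(2) unfolding first_return_def by auto
  moreover have "z = real l / 2 ^ Suc m + 1 / 2 ^ Suc m"
    using ml(1) by (simp add: field_simps)
  ultimately show ?thesis by (rule that)
qed

text \<open>The walk of x is positive, so a dyadic x would be the right end point of a generation 1
  interval; these are closed and hence removed with their end points.\<close>

lemma X_star_not_dyadic:
  assumes "x \<in> X_star" "0 < x" "x < 1 / 2"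
  shows "2 ^ n * x \<notin> \<int>"
proof
  assume "2 ^ n * x \<in> \<int>"
  moreover have "0 \<le> 2 ^ n * x" using assms by simp
  ultimately obtain k where "2 ^ n * x = real k"
    by (metis Ints_cases of_int_0_le_iff of_int_of_nat_eq zero_le_imp_eq_int)
  then have k: "x = real k / 2 ^ n" by (simp add: field_simps)
  have "0 < sign_sum j x" if "j \<in> {1..<n}" for j
    using sign_sum_pos[of x j] X_star_sign_sum_nonzero[of x] assms that by auto
  with k assms obtain m z where "first_return m z" "x = z + 1 / 2 ^ m"
    using right_end_of_first_return by metis
  moreover from this(2) have "x \<in> {z..z + 1 / 2 ^ m}" by simp
  ultimately show False using assms(1) unfolding X_star_iff by blast
qed

section \<open>Values of T on generation 1 intervals and on \<open>X_star\<close>\<close>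

text \<open>The slope D_n vanishes at a first return, so T (z + h/2^n) = T z + T h / 2^n, with T
  \<ge> 0 and T 1 = 0.\<close>

lemma takagi_first_return:
  assumes "first_return n z"
  shows "takagi (z + 1 / 2 ^ n) = takagi z"
    and "t \<in> {z..z + 1 / 2 ^ n} \<Longrightarrow> takagi z \<le> takagi t"
proof -
  obtain k where k: "k < 2 ^ n" "z = real k / 2 ^ n" "sign_sum n z = 0"
    using assms by (auto simp: first_return_def)
  have *: "takagi (z + h / 2 ^ n) = takagi z + takagi h / 2 ^ n" if "0 \<le> h" "h \<le> 1" for h
    using takagi_dyadic_affine[OF k(1) that] k(2,3) by simp
  show "takagi (z + 1 / 2 ^ n) = takagi z" using *[of 1] by simp
  assume t: "t \<in> {z..z + 1 / 2 ^ n}"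
  have "takagi t = takagi (z + 2 ^ n * (t - z) / 2 ^ n)" by simp
  also have "\<dots> = takagi z + takagi (2 ^ n * (t - z)) / 2 ^ n"
    using t by (intro *) (auto simp: field_simps)
  finally show "takagi z \<le> takagi t" using takagi_nonneg by simp
qed

lemma X_star_sign_sum_double:
  assumes "x \<in> X_star" "x < 1 / 2"
  shows "- 1 < sign_sum j (2 * x)"
proof -
  have "0 \<le> x" using assms(1) by (simp add: X_star_iff)
  then show ?thesis
    using sign_sum_pos[of x "Suc j"] X_star_sign_sum_nonzero[OF assms(1)]
      sign_sum_half[of "2 * x" j] assms(2) by auto
qed

text \<open>Left of 1/2, put v = 2 x: T v \<le> 1 - v gives (v + T v)/2 \<le> 1/2. From 1/2 on, T w
  \<le> w does the same for w = 2 x - 1.\<close>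

lemma takagi_X_star_le_half:
  assumes "x \<in> X_star"
  shows "takagi x \<le> 1 / 2"
proof -
  have x: "0 \<le> x" "x \<le> 1" using assms by (auto simp: X_star_iff)
  consider "x < 1 / 2" | "1 / 2 \<le> x" "x < 1" | "x = 1" using x by linarith
  then show ?thesis
  proof cases
    case 1
    then show ?thesis
      using takagi_le_one_minus[of "2 * x" 1] X_star_sign_sum_double[OF assms 1]
        takagi_half[of "2 * x"] x by simp
  next
    case 2
    define w where "w = 2 * x - 1"
    have w: "0 \<le> w" "w < 1" "x = (1 + w) / 2" using 2 by (auto simp: w_def)
    have "sign_sum j w < 1" for j
      using sign_sum_neg[OF 2, of "Suc j"] X_star_sign_sum_nonzero[OF assms 2(2)]
        sign_sum_half_plus[of w j] w by auto
    then show ?thesis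
      using takagi_le_self[of w 1] takagi_half_plus[of w] w(1,2) unfolding w(3) by simp
  qed simp
qed

lemma takagi_less_X_star:
  assumes "x \<in> X_star" "y \<in> X_star" "x < y" "y < 1 / 2"
  shows "takagi x < takagi y"
proof -
  have x: "0 \<le> x" using assms(1) by (simp add: X_star_iff)
  have "2 ^ i * (2 * y) \<notin> \<int>" for i
    using X_star_not_dyadic[of y "Suc i"] assms x by (simp add: mult_ac)
  then have "takagi (2 * x) + of_int 1 * (2 * x) < takagi (2 * y) + of_int 1 * (2 * y)"
    using assms x X_star_sign_sum_double by (intro takagi_plus_linear_less) auto
  then show ?thesis
    using takagi_half[of "2 * x"] takagi_half[of "2 * y"] assms x by simp
qed

section \<open>Surjectivity onto [0, 1/2]\<close>

text \<open>This is the generation 1 interval of 1/4 (digits 0, 1), where T t = 1/2 + T (4 t - 1) /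
  4.\<close>

lemma takagi_ge_half:
  assumes "1 / 4 \<le> t" "t \<le> 1 / 2"
  shows "1 / 2 \<le> takagi t"
proof -
  have "takagi (4 * t - 1) = 2 * takagi (2 * t) - 1 + (4 * t - 1)"
    using takagi_half_plus[of "4 * t - 1"] assms by simp
  moreover have "takagi t = (2 * t + takagi (2 * t)) / 2"
    using takagi_half[of "2 * t"] assms by simp
  ultimately show ?thesis using takagi_nonneg[of "4 * t - 1"] by simp
qed

lemma X_star_takagi_surj:
  assumes "0 < y" "y \<le> 1 / 2"
  shows "y \<in> takagi ` X_star"
proof -
  define S where "S = {t \<in> {0..1/2}. takagi t < y}"
  define a where "a = Sup S"
  have S0: "0 \<in> S" using assms takagi_0 by (simp add: S_def)
  have bdd: "bdd_above S" by (auto simp: S_def intro!: bdd_aboveI[of _ "1/2"])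
  have a0: "0 \<le> a" using S0 bdd by (simp add: a_def cSup_upper)
  have "S \<noteq> {}" using S0 by blast
  then have a1: "a \<le> 1 / 2" unfolding a_def by (rule cSup_least) (simp add: S_def)
  have right: "y \<le> takagi t" if "a < t" "t \<le> 1 / 2" for t
  proof (rule ccontr)
    assume "\<not> y \<le> takagi t"
    then have "t \<in> S" using that a0 by (simp add: S_def)
    then show False using cSup_upper[OF _ bdd] that(1) by (force simp: a_def)
  qed
  have cont: "isCont takagi a"
    using continuous_takagi[of UNIV] by (simp add: continuous_on_eq_continuous_at)
  have ge: "y \<le> takagi a"
  \<comment> \<open>Otherwise T a is the limit of values of T to the right of a; at 1/2
    \<open>right\<close> says nothing, but T (1/2) \<ge> 1/2 \<ge> y.\<close>
  proof (cases "a = 1 / 2")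
    case True
    then show ?thesis using takagi_ge_half[of a] assms by simp
  next
    case False
    then have "a < 1 / 2" using a1 by simp
    have "(takagi \<longlongrightarrow> takagi a) (at_right a)"
      using cont by (auto simp: isCont_def intro: tendsto_mono at_le)
    moreover have "eventually (\<lambda>t. y \<le> takagi t) (at_right a)"
      using eventually_at_right_real[OF \<open>a < 1 / 2\<close>]
      by eventually_elim (use right in auto)
    ultimately show ?thesis by (rule tendsto_lowerbound) simp
  qed
  have "a \<notin> S" using ge by (simp add: S_def)
  have left: "\<exists>t\<in>S. p < t \<and> t < a" if "p < a" for p
    using less_cSupD[OF _ that[unfolded a_def]] S0 bdd cSup_upper \<open>a \<notin> S\<close>
    unfolding a_def by (metis empty_iff order_le_less)
  \<comment> \<open>Since a is not in \<open>S\<close>, points of \<open>S\<close> accumulate at a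
    from the left, so T \<ge> y cannot hold on any (p, a). The contradictions below come from
    this.\<close>
  have ab: False if "p < a" "\<And>t. p < t \<Longrightarrow> t < a \<Longrightarrow> y \<le> takagi t" for p
    using left[OF that(1)] that(2) by (force simp: S_def)
  have le: "takagi a \<le> y"
  proof (rule ccontr)
    assume "\<not> takagi a \<le> y"
    then have "eventually (\<lambda>t. y < takagi t) (at a)"
      using cont by (auto simp: isCont_def intro: order_tendstoD)
    then obtain d where d: "0 < d" "\<And>t. t \<noteq> a \<Longrightarrow> dist t a < d \<Longrightarrow> y < takagi t"
      by (auto simp: eventually_at)
    show False by (rule ab[of "a - d"]) (use d in \<open>force simp: dist_real_def\<close>)+
  qed
  have eq: "takagi a = y" using ge le by simp
  have interval: False if "first_return n z" "z < a" "a \<le> z + 1 / 2 ^ n" "y \<le> takagi z" for n z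
  proof (rule ab[OF that(2)])
    fix t assume "z < t" "t < a"
    then show "y \<le> takagi t" using takagi_first_return(2)[OF that(1), of t] that by simp
  qed
  have "a \<in> X_star"
    unfolding X_star_iff
  proof (intro conjI allI impI notI)
    show "a \<in> {0..1}" using a0 a1 by simp
    fix n z assume fr: "first_return n z" and az: "a \<in> {z..z + 1 / 2 ^ n}"
    obtain k :: nat where k: "k < 2 ^ n" "z = real k / 2 ^ n" and n: "1 \<le> n"
      using fr by (auto simp: first_return_def)
    have "a < 1 / 2"
    proof (rule ccontr)
      assume "\<not> a < 1 / 2"
      then have a: "a = 1 / 2" using a1 by simp
      show False
      proof (rule ab)
        show "1 / 4 < a" by (simp add: a)
        fix t :: real assume "1 / 4 < t" "t < a"
        then show "y \<le> takagi t" using takagi_ge_half[of t] assms(2) a by simp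
      qed
    qed
    then have "z < 1 / 2" using az by simp
    obtain n' where n': "n = Suc n'" using n by (cases n) auto
    \<comment> \<open>As 1/2 is a multiple of 2^-n, z < 1/2 puts the whole interval into [0, 1/2],
      so \<open>right\<close> applies to its right end point.\<close>
    have "real k < 2 ^ n'" using \<open>z < 1 / 2\<close> k(2) n' by (simp add: field_simps)
    then have "k < 2 ^ n'" by (metis of_nat_less_iff of_nat_numeral of_nat_power)
    then have "real (Suc k) \<le> real (2 ^ n')" by (simp only: of_nat_le_iff Suc_le_eq)
    then have b: "z + 1 / 2 ^ n \<le> 1 / 2" using k(2) n' by (simp add: field_simps)
    \<comment> \<open>The right end point is a itself or lies to the right of a; the value there
      equals T z.\<close>
    have "y \<le> takagi (z + 1 / 2 ^ n)"
      using right[OF _ b] az ge by (cases "a = z + 1 / 2 ^ n") auto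
    then have zy: "y \<le> takagi z" using takagi_first_return(1)[OF fr] by simp
    then have "a = z" using interval[OF fr] az by force
    have "a \<noteq> 0" using eq assms(1) by auto
    then have "0 < z" using a0 \<open>a = z\<close> by simp
    have "0 < sign_sum j z" if "j \<in> {1..<n}" for j
      using sign_sum_pos[of z j] \<open>0 < z\<close> \<open>z < 1 / 2\<close> fr that by (auto simp: first_return_def)
    then obtain m x where mx: "first_return m x" "z = x + 1 / 2 ^ m"
      using right_end_of_first_return[OF \<open>0 < z\<close> \<open>z < 1 / 2\<close> k(2)] by blast
    then show False
      using interval[OF mx(1)] takagi_first_return(1)[OF mx(1)] zy \<open>a = z\<close> by simp
  qed
  then show ?thesis using eq by blast
qed

lemma zero_in_X_star: "0 \<in> X_star"
proof -
  have False if "first_return n z" "0 \<in> {z..z + 1 / 2 ^ n}" for n z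
  proof -
    have "0 \<le> z" using that(1) by (auto simp: first_return_def)
    then have "z = 0" using that(2) by simp
    then have "sign_sum n 0 = 0" "1 \<le> n" using that(1) by (auto simp: first_return_def)
    moreover have "sign_sum n 0 = int n" by (simp add: sign_sum_def bin_digit_def)
    ultimately show False by simp
  qed
  then show ?thesis by (auto simp: X_star_iff)
qed

theorem proposition3p2:
  shows "takagi ` X_star = {0..1/2} \<and> strict_mono_on (X_star \<inter> {0..<1/2}) takagi"
proof
  have "y \<in> takagi ` X_star" if "y \<in> {0..1/2}" for y
  proof (cases "y = 0")
    \<comment> \<open>For y = 0 no point has T < y, so the supremum argument has nothing to start
      from; the point 0 is used instead.\<close>
    case True
    then show ?thesis using zero_in_X_star takagi_0 by (metis image_eqI)
  next
    case False
    then show ?thesis using X_star_takagi_surj that by simp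
  qed
  then show "takagi ` X_star = {0..1/2}"
    using takagi_nonneg takagi_X_star_le_half by auto
  show "strict_mono_on (X_star \<inter> {0..<1/2}) takagi"
    using takagi_less_X_star by (auto intro!: strict_mono_onI)
qed

end
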